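(* For any integers $t$ and $t'$ such that $2\le t'<t$, $$\dim(P_t\boxtimes P_{t'})=\left\lceil\frac{t+t'-2}{t'-1}\right\rceil.$$
   Context: $P_n$ is the path on $n$ vertices. For a connected graph $X$, a set $S\subseteq V(X)$ is a metric generator if for every two distinct vertices $x,y$ there is $s\in S$ with $d_X(s,x)\ne d_X(s,y)$; the metric dimension $\dim(X)$ is the minimum cardinality of a metric generator. The strong product $P_t\boxtimes P_{t'}$ has vertex set $V(P_t)\times V(P_{t'})$, with $(a,b)\sim(c,d)$ iff ($a=c$ and $b\sim d$) or ($b=d$ and $a\sim c$) or ($a\sim c$ and $b\sim d$). *)

theory Defs
  imports Complex_Main "Graph_Theory.Graph_Theory"
begin

text \<open>Undirected simple graphs are symmetric loop-free pair digraphs: each edge is represented by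
  its two opposite arcs.\<close>

definition path_graph :: "nat \<Rightarrow> nat pair_pre_digraph" where
  "path_graph n = \<lparr> pverts = {..<n},
     parcs = {(i, j). i < n \<and> j < n \<and> (j = Suc i \<or> i = Suc j)} \<rparr>"

definition strong_product ::
    "'a pair_pre_digraph \<Rightarrow> 'b pair_pre_digraph \<Rightarrow> ('a \<times> 'b) pair_pre_digraph" where
  "strong_product G H = \<lparr> pverts = pverts G \<times> pverts H,
     parcs = {((a, b), (c, d)) | a b c d.
        a \<in> pverts G \<and> c \<in> pverts G \<and> b \<in> pverts H \<and> d \<in> pverts H \<and>
        (a = c \<and> (b, d) \<in> parcs H
         \<or> b = d \<and> (a, c) \<in> parcs G
         \<or> (a, c) \<in> parcs G \<and> (b, d) \<in> parcs H)} \<rparr>"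

text \<open>With unit weights, the shortest-path weight is the usual graph distance.\<close>

definition graph_dist :: "'a pair_pre_digraph \<Rightarrow> 'a \<Rightarrow> 'a \<Rightarrow> ereal" where
  "graph_dist G u v = wf_digraph.\<mu> (with_proj G) (\<lambda>_. 1) u v"

definition metric_generator :: "'a pair_pre_digraph \<Rightarrow> 'a set \<Rightarrow> bool" where
  "metric_generator G S \<longleftrightarrow> S \<subseteq> pverts G \<and>
     (\<forall>x\<in>pverts G. \<forall>y\<in>pverts G. x \<noteq> y \<longrightarrow> (\<exists>s\<in>S. graph_dist G s x \<noteq> graph_dist G s y))"

text \<open>Finiteness is required because \<^const>\<open>card\<close> is \<open>0\<close> on infinite sets.\<close>

definition metric_dim :: "'a pair_pre_digraph \<Rightarrow> nat" where
  "metric_dim G = (LEAST k. \<exists>S. finite S \<and> metric_generator G S \<and> card S = k)"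

lemma pair_graph_path_graph: "pair_graph (path_graph n)"
proof -
  have "parcs (path_graph n) \<subseteq> {..<n} \<times> {..<n}"
    by (auto simp: path_graph_def)
  then have "finite (parcs (path_graph n))"
    by (rule finite_subset) auto
  then show ?thesis
    by unfold_locales (auto simp: path_graph_def symmetric_def intro!: symI)
qed

lemma pair_graph_strong_product:
  assumes "pair_graph G" "pair_graph H"
  shows "pair_graph (strong_product G H)"
proof -
  interpret G: pair_graph G by fact
  interpret H: pair_graph H by fact
  have "parcs (strong_product G H) \<subseteq> (pverts G \<times> pverts H) \<times> (pverts G \<times> pverts H)"
    by (auto simp: strong_product_def)
  then have "finite (parcs (strong_product G H))"
    by (rule finite_subset) (simp add: G.pair_finite_verts H.pair_finite_verts)
  moreover have "sym (parcs (strong_product G H))"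
    using G.pair_sym_arcs H.pair_sym_arcs
    by (auto simp: strong_product_def symmetric_def intro!: symI dest: symD)
  ultimately show ?thesis
    using G.pair_no_loops H.pair_no_loops
    by unfold_locales
      (auto simp: strong_product_def symmetric_def G.pair_finite_verts H.pair_finite_verts)
qed

lemma graph_dist_eq:
  assumes "pair_wf_digraph G"
  shows "graph_dist G u v
    = (INF p\<in>{p. pre_digraph.awalk (with_proj G) u p v}. ereal (real (length p)))"
proof -
  interpret pair_wf_digraph G by fact
  have "awalk_cost (\<lambda>_. 1) p = real (length p)" for p :: "('a \<times> 'a) list"
    by (induction p) auto
  then show ?thesis
    by (simp add: graph_dist_def \<mu>_def)
qed

lemma path_graph_reachable:
  assumes "i < n" "j < n"
  shows "i \<rightarrow>\<^sup>*\<^bsub>with_proj (path_graph n)\<^esub> j"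
proof -
  interpret pair_graph "path_graph n" by (rule pair_graph_path_graph)
  have "j < n \<Longrightarrow> 0 \<rightarrow>\<^sup>*\<^bsub>with_proj (path_graph n)\<^esub> j" for j
  proof (induction j)
    case 0
    then show ?case by (intro reachable_refl) (simp add: path_graph_def)
  next
    case (Suc j)
    then have "j \<rightarrow>\<^bsub>with_proj (path_graph n)\<^esub> Suc j"
      by (simp add: path_graph_def)
    then have "j \<rightarrow>\<^sup>*\<^bsub>with_proj (path_graph n)\<^esub> Suc j"
      by (intro reachable_adjI) simp
    with Suc show ?case
      using reachable_trans Suc_lessD by blast
  qed
  with assms show ?thesis
    using reachable_trans[OF symmetric_reachable[OF sym_arcs]] by blast
qed

lemma connected_strong_product_path_graph:
  assumes "m > 0" "n > 0"
  shows "connected (with_proj (strong_product (path_graph m) (path_graph n)))"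
proof -
  let ?G = "strong_product (path_graph m) (path_graph n)"
  interpret G: pair_graph ?G
    by (intro pair_graph_strong_product pair_graph_path_graph)
  interpret P: pair_graph "path_graph m" by (rule pair_graph_path_graph)
  interpret Q: pair_graph "path_graph n" by (rule pair_graph_path_graph)
  have 1: "(a, b) \<rightarrow>\<^sup>*\<^bsub>with_proj ?G\<^esub> (c, b)"
    if "a \<rightarrow>\<^sup>*\<^bsub>with_proj (path_graph m)\<^esub> c" "b < n" for a b c
    using that(1)
  proof (induction rule: P.reachable_induct)
    case base
    then show ?case using that by (intro G.reachable_refl) (simp add: strong_product_def path_graph_def)
  next
    case (step x y)
    then have "(x, b) \<rightarrow>\<^bsub>with_proj ?G\<^esub> (y, b)"
      using that by (auto simp: strong_product_def path_graph_def)
    then show ?case using step.IH G.reachable_trans[OF _ G.reachable_adjI] by simp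
  qed
  have 2: "(a, b) \<rightarrow>\<^sup>*\<^bsub>with_proj ?G\<^esub> (a, d)"
    if "b \<rightarrow>\<^sup>*\<^bsub>with_proj (path_graph n)\<^esub> d" "a < m" for a b d
    using that(1)
  proof (induction rule: Q.reachable_induct)
    case base
    then show ?case using that by (intro G.reachable_refl) (simp add: strong_product_def path_graph_def)
  next
    case (step x y)
    then have "(a, x) \<rightarrow>\<^bsub>with_proj ?G\<^esub> (a, y)"
      using that by (auto simp: strong_product_def path_graph_def)
    then show ?case using step.IH G.reachable_trans[OF _ G.reachable_adjI] by simp
  qed
  have "(a, b) \<rightarrow>\<^sup>*\<^bsub>with_proj ?G\<^esub> (c, d)"
    if "a < m" "b < n" "c < m" "d < n" for a b c d
    using G.reachable_trans[OF 1[OF path_graph_reachable[of a m c]] 2[OF path_graph_reachable[of b n d]]]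
      that by blast
  then have "strongly_connected (with_proj ?G)"
    using assms by (auto simp: strongly_connected_def strong_product_def path_graph_def)
  then show ?thesis
    using G.reachable_mk_symmetricI
    by (auto simp: connected_def strongly_connected_def mk_symmetric_def)
qed

end

theory Submission
  imports Defs
begin

text \<open>The graph distance of the strong product is the Chebyshev distance. Put \<open>m = t - 1\<close> and
  \<open>n = t' - 1\<close>; the claim is that the dimension is \<open>\<lceil>m / n\<rceil> + 1\<close>.

  For the upper bound, take the zigzag of points with abscissae \<open>0, n, 2n, \<dots>, m\<close> lying alternately
  on the two long sides.

  For the lower bound, only pairs in a common column \<open>c\<close> matter. A point at horizontal distance
  \<open>d\<close> from the column and height \<open>y\<close> cannot separate heights in \<open>[y - d, y + d]\<close>, so the column is
  resolved only if it contains a chosen point or two chosen points have horizontal distances to it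
  adding up to at most \<open>n\<close>. For the sorted abscissae \<open>x\<^sub>0 \<le> x\<^sub>1 \<le> \<dots>\<close> this forces
  \<open>x\<^sub>0 + x\<^sub>1 \<le> n\<close> and \<open>x\<^sub>j\<^sub>+\<^sub>2 - x\<^sub>j \<le> 2n\<close>, and reaching column \<open>m\<close> then requires \<open>m \<le> n (k - 1)\<close>
  for \<open>k\<close> points.\<close>

section \<open>Distances in the strong product of two paths\<close>

definition chebyshev_dist :: "nat \<times> nat \<Rightarrow> nat \<times> nat \<Rightarrow> int" where
  "chebyshev_dist u v = max \<bar>int (fst u) - int (fst v)\<bar> \<bar>int (snd u) - int (snd v)\<bar>"

abbreviation path_product :: "nat \<Rightarrow> nat \<Rightarrow> (nat \<times> nat) pair_pre_digraph" where
  "path_product m n \<equiv> strong_product (path_graph m) (path_graph n)"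

lemma pverts_path_product: "pverts (path_product m n) = {..<m} \<times> {..<n}"
  by (simp add: strong_product_def path_graph_def)

lemma parcs_path_product_iff:
  "(u, v) \<in> parcs (path_product m n) \<longleftrightarrow>
    u \<in> pverts (path_product m n) \<and> v \<in> pverts (path_product m n) \<and> chebyshev_dist u v = 1"
  by (cases u; cases v) (auto simp: strong_product_def path_graph_def chebyshev_dist_def max_def)

lemma chebyshev_dist_triangle:
  "chebyshev_dist u w \<le> chebyshev_dist u v + chebyshev_dist v w"
  by (auto simp: chebyshev_dist_def)

lemma chebyshev_dist_le_awalk_length:
  assumes "pre_digraph.awalk (with_proj (path_product m n)) u p v"
  shows "chebyshev_dist u v \<le> int (length p)"
proof -
  interpret pair_graph "path_product m n"
    by (intro pair_graph_strong_product pair_graph_path_graph)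
  show ?thesis
    using assms
  proof (induction p arbitrary: u)
    case Nil
    then show ?case by (simp add: awalk_Nil_iff chebyshev_dist_def)
  next
    case (Cons e p)
    then have e: "e \<in> parcs (path_product m n)" "fst e = u" and p: "awalk (snd e) p v"
      by (auto simp: awalk_Cons_iff)
    then have "chebyshev_dist u (snd e) = 1"
      using parcs_path_product_iff by (metis prod.collapse)
    then show ?case
      using Cons.IH[OF p] chebyshev_dist_triangle[of u v "snd e"] by simp
  qed
qed

text \<open>Moving every coordinate that differs one unit towards its target, both at once if
  necessary, is a single arc and lowers the larger difference by exactly one.\<close>

lemma ex_awalk_chebyshev_dist:
  assumes "u \<in> pverts (path_product m n)" "v \<in> pverts (path_product m n)"
    and "chebyshev_dist u v = int d"
  shows "\<exists>p. pre_digraph.awalk (with_proj (path_product m n)) u p v \<and> length p = d"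
proof -
  interpret pair_graph "path_product m n"
    by (intro pair_graph_strong_product pair_graph_path_graph)
  show ?thesis
    using assms
  proof (induction d arbitrary: u)
    case 0
    then have "u = v" by (auto simp: chebyshev_dist_def prod_eq_iff)
    with 0 show ?case by (auto simp: awalk_Nil_iff)
  next
    case (Suc d)
    define closer :: "nat \<Rightarrow> nat \<Rightarrow> nat" where
      "closer a b = (if a < b then a + 1 else if b < a then a - 1 else a)" for a b
    define w where "w = (closer (fst u) (fst v), closer (snd u) (snd v))"
    have w: "w \<in> pverts (path_product m n)"
      using Suc.prems by (auto simp: w_def closer_def pverts_path_product)
    have "chebyshev_dist w v = int d" "chebyshev_dist u w = 1"
      using Suc.prems(3) by (auto simp: w_def closer_def chebyshev_dist_def max_def split: if_splits)
    with w Suc.prems obtain p where p: "awalk w p v" "length p = d"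
      using Suc.IH[of w] by blast
    moreover have "(u, w) \<in> parcs (path_product m n)"
      using w Suc.prems \<open>chebyshev_dist u w = 1\<close> by (simp add: parcs_path_product_iff)
    ultimately have "awalk u ((u, w) # p) v"
      by (auto simp: awalk_Cons_iff)
    with p show ?case by (intro exI[of _ "(u, w) # p"]) auto
  qed
qed

lemma graph_dist_path_product:
  assumes "u \<in> pverts (path_product m n)" "v \<in> pverts (path_product m n)"
  shows "graph_dist (path_product m n) u v = ereal (of_int (chebyshev_dist u v))"
proof -
  interpret pair_graph "path_product m n"
    by (intro pair_graph_strong_product pair_graph_path_graph)
  have "chebyshev_dist u v \<ge> 0" by (simp add: chebyshev_dist_def le_max_iff_disj)
  then obtain d where d: "chebyshev_dist u v = int d" using nonneg_int_cases by blast
  obtain p where p: "awalk u p v" "length p = d"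
    using ex_awalk_chebyshev_dist[OF assms d] by blast
  have "graph_dist (path_product m n) u v
      = (INF p\<in>{p. awalk u p v}. ereal (real (length p)))"
    by (rule graph_dist_eq) unfold_locales
  also have "\<dots> = ereal (real d)"
  proof (rule antisym)
    show "(INF p\<in>{p. awalk u p v}. ereal (real (length p))) \<le> ereal (real d)"
      using p by (intro INF_lower2[of p]) auto
    show "ereal (real d) \<le> (INF p\<in>{p. awalk u p v}. ereal (real (length p)))"
      using chebyshev_dist_le_awalk_length d by (intro INF_greatest) fastforce
  qed
  finally show ?thesis by (simp add: d)
qed

lemma metric_generator_path_product_iff:
  "metric_generator (path_product m n) S \<longleftrightarrow> S \<subseteq> {..<m} \<times> {..<n} \<and>
    (\<forall>u\<in>{..<m} \<times> {..<n}. \<forall>v\<in>{..<m} \<times> {..<n}. u \<noteq> v \<longrightarrow>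
      (\<exists>s\<in>S. chebyshev_dist s u \<noteq> chebyshev_dist s v))"
proof -
  have "graph_dist (path_product m n) s u = graph_dist (path_product m n) s v
      \<longleftrightarrow> chebyshev_dist s u = chebyshev_dist s v"
    if "s \<in> {..<m} \<times> {..<n}" "u \<in> {..<m} \<times> {..<n}" "v \<in> {..<m} \<times> {..<n}" for s u v
    using that by (simp add: graph_dist_path_product pverts_path_product)
  then show ?thesis
    unfolding metric_generator_def pverts_path_product by (metis (no_types, lifting) subsetD)
qed

section \<open>Upper bound: the zigzag resolves every pair\<close>

text \<open>Within a column, the two consecutive zigzag points around it decide. For distinct
  columns, zigzag points to the left confine an unresolved pair to the columns \<open>0\<close> to
  \<open>n\<close>, where the first three points suffice.\<close>

lemma zigzag_metric_generator:
  fixes m n K :: nat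
  assumes n: "1 \<le> n" and "n < m" and K: "n * (K - 1) < m" "m \<le> n * K"
  defines "z \<equiv> (\<lambda>i. (min (i * n) m, if even i then 0 else n))"
  shows "metric_generator (path_product (Suc m) (Suc n)) (z ` {..K})"
  unfolding metric_generator_path_product_iff
proof (intro conjI ballI impI)
  show "z ` {..K} \<subseteq> {..<Suc m} \<times> {..<Suc n}" by (auto simp: z_def)
  have K2: "2 \<le> K"
    using \<open>n < m\<close> K(2) by (metis less_2_cases_iff linorder_not_less mult.right_neutral mult_0_right not_less_zero order_less_le_trans One_nat_def)
  have column: "\<exists>s\<in>z ` {..K}. chebyshev_dist s (a, b) \<noteq> chebyshev_dist s (a, d)"
    if "b < d" "d \<le> n" "a \<le> m" for a b d
  proof (rule ccontr)
    assume "\<not> ?thesis"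
    then have eq: "chebyshev_dist (z i) (a, b) = chebyshev_dist (z i) (a, d)" if "i \<le> K" for i
      using that by auto
    \<comment> \<open>\<open>z i\<close> and \<open>z (Suc i)\<close> enclose column
      \<open>a\<close>. If \<open>m = n * K\<close>, then \<open>m div n\<close> is \<open>K\<close>
      and \<open>Suc K\<close> is out of range, hence the special case.\<close>
    define i where "i = (if a = m then K - 1 else a div n)"
    have i: "i * n \<le> a" "a \<le> min (Suc i * n) m"
    proof -
      show "i * n \<le> a"
        using K by (auto simp: i_def mult.commute)
      show "a \<le> min (Suc i * n) m"
      proof (cases "a = m")
        case True
        then have "Suc i = K" using K2 by (simp add: i_def)
        then show ?thesis using True K(2) by (simp add: mult.commute)
      next
        case False
        then show ?thesis
          using that(3) n dividend_less_times_div[of n a] by (simp add: i_def mult.commute)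
      qed
    qed
    have "i < K"
    proof (cases "a = m")
      case False
      with \<open>a \<le> m\<close> K have "a < K * n" by (simp add: mult.commute)
      with False show ?thesis by (simp add: i_def less_mult_imp_div_less)
    qed (use K2 in \<open>simp add: i_def\<close>)
    obtain p where p: "a = i * n + p" using i le_Suc_ex by blast
    obtain r where r: "min (Suc i * n) m = a + r" using i le_Suc_ex by blast
    have "a + r \<le> Suc i * n" using r by (metis min.cobounded1)
    then have "p + r \<le> n" using p by simp
    have z_i: "z i = (i * n, if even i then 0 else n)" "z (Suc i) = (a + r, if even i then n else 0)"
      using i r by (simp_all add: z_def)
    \<comment> \<open>The point on the bottom side fails only if the upper height is at most its
      distance to the column. The point on the top side fails only if the lower height is at least
      \<open>n\<close> minus its own distance. As \<open>p + r \<le> n\<close>, both cannot hold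
      when \<open>b < d\<close>.\<close>
    have "max (int p) \<bar>int (snd (z i)) - int b\<bar> = max (int p) \<bar>int (snd (z i)) - int d\<bar>"
      "max (int r) \<bar>int (snd (z (Suc i))) - int b\<bar> = max (int r) \<bar>int (snd (z (Suc i))) - int d\<bar>"
      using eq[of i] eq[of "Suc i"] \<open>i < K\<close> p by (auto simp: z_i chebyshev_dist_def)
    then show False
      using \<open>p + r \<le> n\<close> that by (cases "even i") (auto simp: z_i max_def split: if_splits)
  qed
  have columns: "\<exists>s\<in>z ` {..K}. chebyshev_dist s (a, b) \<noteq> chebyshev_dist s (c, d)"
    if "a < c" "c \<le> m" "b \<le> n" "d \<le> n" for a b c d
  proof (rule ccontr)
    assume "\<not> ?thesis"
    then have eq: "chebyshev_dist (z i) (a, b) = chebyshev_dist (z i) (c, d)" if "i \<le> K" for i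
      using that by auto
    \<comment> \<open>Heights differ by at most \<open>n\<close>, so beyond horizontal distance
      \<open>n\<close> the column alone fixes the distance from \<open>z i\<close>, and it then
      exceeds the distance to the nearer column.\<close>
    have left: "c \<le> i * n + n" if "i * n \<le> a" for i
    proof -
      have "i * n < K * n"
        using that \<open>a < c\<close> \<open>c \<le> m\<close> K(2) mult.commute[of n K] by linarith
      then have "i \<le> K" by simp
      have "min (i * n) m = i * n" using that \<open>a < c\<close> \<open>c \<le> m\<close> by simp
      then obtain h where h: "h \<le> n" "z i = (i * n, h)" by (cases "even i") (auto simp: z_def)
      show ?thesis
      proof (rule ccontr)
        assume "\<not> ?thesis"
        then have "chebyshev_dist (z i) (a, b) < int c - int (i * n)"
          unfolding chebyshev_dist_def h(2) fst_conv snd_conv max_less_iff_conj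
          using h(1) that \<open>a < c\<close> \<open>b \<le> n\<close> by linarith
        also have "\<dots> \<le> chebyshev_dist (z i) (c, d)"
          unfolding chebyshev_dist_def h(2) fst_conv snd_conv by linarith
        finally show False using eq[OF \<open>i \<le> K\<close>] by simp
      qed
    qed
    have "a div n = 0"
    proof (rule ccontr)
      assume "a div n \<noteq> 0"
      then obtain j where j: "a div n = Suc j" using not0_implies_Suc by blast
      have "Suc j * n \<le> a" using j by (metis div_times_less_eq_dividend)
      then show False using left[of j] \<open>a < c\<close> by auto
    qed
    then have "a < n" using n by (simp add: div_eq_0_iff)
    have "c \<le> n" using left[of 0] by simp
    \<comment> \<open>\<open>z 0\<close> and \<open>z 1\<close> are the opposite corners
      \<open>(0, 0)\<close> and \<open>(n, n)\<close>: they fix the maximum and the minimum of the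
      coordinates. Only the mirrored pair \<open>b = c\<close>, \<open>d = a\<close> remains, and
      \<open>z 2\<close> separates it.\<close>
    show False
      using eq[of 0] eq[of 1] eq[of 2] K2 n \<open>n < m\<close> \<open>a < n\<close> \<open>c \<le> n\<close> that
      by (auto simp: z_def chebyshev_dist_def max_def split: if_splits)
  qed
  fix u v :: "nat \<times> nat"
  assume uv: "u \<in> {..<Suc m} \<times> {..<Suc n}" "v \<in> {..<Suc m} \<times> {..<Suc n}" "u \<noteq> v"
  obtain a b c d where [simp]: "u = (a, b)" "v = (c, d)" by (cases u, cases v)
  consider "a < c" | "c < a" | "a = c" "b < d" | "a = c" "d < b"
    using uv(3) by fastforce
  then show "\<exists>s\<in>z ` {..K}. chebyshev_dist s u \<noteq> chebyshev_dist s v"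
  proof cases
    case 1 then show ?thesis using columns[of a c b d] uv by auto
  next
    case 2 then show ?thesis using columns[of c a d b] uv by fastforce
  next
    case 3 then show ?thesis using column[of b d a] uv by auto
  next
    case 4 then show ?thesis using column[of d b a] uv by fastforce
  qed
qed

section \<open>Lower bound: what resolving a single column requires\<close>

lemma column_cover:
  fixes m n c :: nat
  assumes gen: "metric_generator (path_product (Suc m) (Suc n)) S" and fin: "finite S"
    and n: "1 \<le> n" and c: "c \<le> m"
  shows "(\<exists>s\<in>S. fst s = c) \<or> (\<exists>s\<in>S. \<exists>s'\<in>S. s \<noteq> s' \<and>
    \<bar>int (fst s) - int c\<bar> + \<bar>int (fst s') - int c\<bar> \<le> int n)"
proof (rule ccontr)
  assume neg: "\<not> ?thesis"
  have S: "snd s \<le> n" if "s \<in> S" for s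
    using gen that by (auto simp: metric_generator_path_product_iff)
  define d where "d s = \<bar>int (fst s) - int c\<bar>" for s :: "nat \<times> nat"
  \<comment> \<open>\<open>L\<close> and \<open>U\<close> bound the intersection of all intervals of
    heights that a chosen point cannot separate, clipped to \<open>0\<close> and \<open>n\<close>.
    If \<open>L < U\<close>, the heights \<open>L\<close> and \<open>L + 1\<close> stay
    unresolved.\<close>
  define U where "U = Min (insert (int n) ((\<lambda>s. int (snd s) + d s) ` S))"
  define L where "L = Max (insert 0 ((\<lambda>s. int (snd s) - d s) ` S))"
  have pos: "d s > 0" if "s \<in> S" for s using neg that by (auto simp: d_def)
  have pair: "d s + d s' > int n" if "s \<in> S" "s' \<in> S" "s \<noteq> s'" for s s'
    using neg that by (force simp: d_def)
  have "U \<in> insert (int n) ((\<lambda>s. int (snd s) + d s) ` S)"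
    unfolding U_def using fin by (intro Min_in) auto
  moreover have "L \<in> insert 0 ((\<lambda>s. int (snd s) - d s) ` S)"
    unfolding L_def using fin by (intro Max_in) auto
  \<comment> \<open>For distinct points, the heights differ by at most \<open>n\<close>, which is
    less than \<open>d s + d s'\<close>; for a single point, \<open>d s > 0\<close> because the
    column avoids \<open>S\<close>.\<close>
  moreover have "int (snd s) - d s < int (snd s') + d s'" if "s \<in> S" "s' \<in> S" for s s'
    using pair[of s s'] pos[of s] S[of s] that by (cases "s = s'") auto
  ultimately have "L < U" using n S pos by (fastforce intro: add_nonneg_pos)
  have UL: "U \<le> int n" "0 \<le> L" using fin by (auto simp: U_def L_def)
  define l where "l = nat L"
  have l: "int l = L" using UL by (simp add: l_def)
  have "chebyshev_dist s (c, l) = chebyshev_dist s (c, Suc l)" if "s \<in> S" for s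
  proof -
    have "U \<le> int (snd s) + d s" "int (snd s) - d s \<le> L"
      using fin that by (auto simp: U_def L_def)
    then show ?thesis using \<open>L < U\<close> l by (auto simp: chebyshev_dist_def d_def)
  qed
  moreover have "(c, l) \<in> {..<Suc m} \<times> {..<Suc n}" "(c, Suc l) \<in> {..<Suc m} \<times> {..<Suc n}"
    using c \<open>L < U\<close> UL l by auto
  ultimately show False
    using gen unfolding metric_generator_path_product_iff by (metis n_not_Suc_n prod.inject)
qed

section \<open>Lower bound: spacing of sorted abscissae\<close>

text \<open>Here \<open>a\<close>, \<open>b\<close>, \<open>d\<close> stand for consecutive
  abscissae with a wide gap after \<open>b\<close>. A column \<open>c\<close> in that gap is served
  by \<open>a\<close> and \<open>b\<close>, or by \<open>d\<close> and its successor, which is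
  replaced by the weaker bound \<open>d\<close>. The first column out of reach of \<open>a\<close>
  and \<open>b\<close> must be near \<open>d\<close>.\<close>

lemma adjacent_gaps_bound:
  fixes a b d n :: int
  assumes gap: "\<And>c. b < c \<Longrightarrow> c < d \<Longrightarrow> 2 * c - b - a \<le> n \<or> 2 * d - 2 * c \<le> n"
    and "d - b > n" "1 \<le> n" "a \<le> b"
  shows "d - a \<le> 2 * n"
proof -
  \<comment> \<open>At column \<open>b + 1\<close> the second alternative fails, since
    \<open>d - b > n\<close>.\<close>
  have less: "b - a \<le> n - 2"
    using gap[of "b + 1"] assms(2,3) by presburger
  text \<open>\<open>b + 1 + q\<close> is the first column that the first alternative of \<open>gap\<close> excludes.\<close>
  define q where "q = (n - (b - a)) div 2"
  have q: "2 * q \<le> n - (b - a)" "n - (b - a) \<le> 2 * q + 1"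
    by (auto simp: q_def)
  have "n < 2 * (b + 1 + q) - b - a" using q by presburger
  moreover have "b < b + 1 + q" using less q by linarith
  moreover have "b + 1 + q < d" using assms less q by linarith
  ultimately have "2 * d - 2 * (b + 1 + q) \<le> n" using gap[of "b + 1 + q"] by linarith
  then show ?thesis using q less assms(3) by presburger
qed

text \<open>Sums of two neighbouring abscissae are tracked: the first is at most \<open>n\<close>,
  each next one grows by at most \<open>2 * n\<close>, and the last must be at least
  \<open>2 * m - n\<close>.\<close>

lemma sorted_cover_bound:
  fixes x :: "nat \<Rightarrow> int" and n m :: int
  assumes n: "1 \<le> n" and m: "0 < m"
    and mono: "\<And>i j. i \<le> j \<Longrightarrow> j < k \<Longrightarrow> x i \<le> x j"
    and range: "\<And>i. i < k \<Longrightarrow> 0 \<le> x i \<and> x i \<le> m"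
    and cover: "\<And>c. 0 \<le> c \<Longrightarrow> c \<le> m \<Longrightarrow> (\<exists>i<k. x i = c) \<or>
      (\<exists>i j. i < j \<and> j < k \<and> \<bar>x i - c\<bar> + \<bar>x j - c\<bar> \<le> n)"
  shows "m \<le> n * (int k - 1)"
proof -
  have k: "2 \<le> k"
  proof (rule ccontr)
    assume "\<not> ?thesis"
    then have "k = 0 \<or> k = 1" by auto
    then show False using cover[of 0] cover[of m] m by auto
  qed
  \<comment> \<open>A covering pair cannot straddle a gap wider than \<open>n\<close>, so it lies on
    one side, and the two nearest points on that side do at least as well. The existential over
    \<open>i\<close> accounts for \<open>j = 0\<close>, where no two points lie to the left.\<close>
  have wide_gap: "(\<exists>i. j = Suc i \<and> 2 * c - x j - x i \<le> n) \<or>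
      (Suc (Suc j) < k \<and> x (Suc j) + x (Suc (Suc j)) - 2 * c \<le> n)"
    if j: "Suc j < k" "x (Suc j) - x j > n" and c: "x j < c" "c < x (Suc j)" for j c
  proof -
    have "0 \<le> c" "c \<le> m" using range[of j] range[of "Suc j"] j c by auto
    moreover have "x i \<noteq> c" if "i < k" for i
      using mono[of i j] mono[of "Suc j" i] that j c by (cases "i \<le> j") auto
    ultimately obtain i l where il: "i < l" "l < k" "\<bar>x i - c\<bar> + \<bar>x l - c\<bar> \<le> n"
      using cover by blast
    consider "l \<le> j" | "i \<le> j" "Suc j \<le> l" | "Suc j \<le> i" by linarith
    then show ?thesis
    proof cases
      case 1
      then obtain h where h: "j = Suc h" using il(1) by (cases j) auto
      have "x l \<le> x j" "x i \<le> x h"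
        using mono[of l j] mono[of i h] 1 il h j by auto
      then show ?thesis using il(3) h by auto
    next
      case 2
      then show ?thesis using mono[of i j] mono[of "Suc j" l] il j by auto
    next
      case 3
      then have "x (Suc j) \<le> x i" "x (Suc (Suc j)) \<le> x l" "Suc (Suc j) < k"
        using mono[of "Suc j" i] mono[of "Suc (Suc j)" l] il by auto
      then show ?thesis using il(3) by auto
    qed
  qed
  have step: "x (Suc (Suc j)) - x j \<le> 2 * n" if j: "Suc (Suc j) < k" for j
  proof (rule ccontr)
    assume far: "\<not> ?thesis"
    define a b d where abd: "a = x j" "b = x (Suc j)" "d = x (Suc (Suc j))"
    have ord: "a \<le> b" "b \<le> d" using mono[of j "Suc j"] mono[of "Suc j" "Suc (Suc j)"] j
      by (auto simp: abd)
    have far': "d - a > 2 * n" using far by (simp add: abd)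
    show False
    proof (cases "d - b > n")
      case True
      have gap: "2 * c - b - a \<le> n \<or> 2 * d - 2 * c \<le> n" if "b < c" "c < d" for c
        using wide_gap[of "Suc j" c] mono[of "Suc (Suc j)" "Suc (Suc (Suc j))"] j True that
        unfolding abd by fastforce
      then show False using adjacent_gaps_bound[OF gap] True n ord far' by fastforce
    next
      case False
      then have True: "b - a > n" using far' by linarith
      have gap: "2 * c - 2 * a \<le> n \<or> b + d - 2 * c \<le> n" if "a < c" "c < b" for c
        using wide_gap[of j c] mono[of "j - 1" j] j True that
        unfolding abd by fastforce
      \<comment> \<open>Negation reverses the order, so \<open>- d\<close>, \<open>- b\<close>,
        \<open>- a\<close> take the places of \<open>a\<close>, \<open>b\<close>,
        \<open>d\<close>.\<close>
      have "2 * c - - b - - d \<le> n \<or> 2 * - a - 2 * c \<le> n" if "- b < c" "c < - a" for c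
        using gap[of "- c"] that by linarith
      from adjacent_gaps_bound[OF this] show False using True n ord far' by fastforce
    qed
  qed
  have base: "x 0 + x 1 \<le> n"
  proof (cases "x 0 = 0")
    case True
    show ?thesis
    proof (rule ccontr)
      assume "\<not> ?thesis"
      with True have "x 1 > n" by simp
      \<comment> \<open>Column \<open>1\<close> has only one point to its left, and those to its
        right are too far away.\<close>
      then show False
        using wide_gap[of 0 1] mono[of 1 2] True k n by (auto simp: numeral_2_eq_2)
    qed
  next
    case False
    then have pos: "x i > 0" if "i < k" for i using mono[of 0 i] range[of 0] that k by fastforce
    then obtain i j where "i < j" "j < k" "\<bar>x i\<bar> + \<bar>x j\<bar> \<le> n"
      using cover[of 0] m by fastforce
    moreover from this have "x 0 \<le> x i" "x 1 \<le> x j" using mono by auto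
    ultimately show ?thesis by linarith
  qed
  have sum_bound: "x j + x (Suc j) \<le> n * (2 * int j + 1)" if "Suc j < k" for j
    using that
  proof (induction j)
    case 0
    then show ?case using base by simp
  next
    case (Suc j)
    then have "x j + x (Suc j) \<le> n * (2 * int j + 1)" "x (Suc (Suc j)) - x j \<le> 2 * n"
      using step by auto
    then show ?case by (simp add: algebra_simps)
  qed
  obtain h where h: "k = Suc (Suc h)" using k by (metis add_2_eq_Suc le_Suc_ex)
  \<comment> \<open>The mirror image of \<open>base\<close> at the other end, with
    \<open>m - 1\<close> as the critical column.\<close>
  have "2 * m \<le> n + (x h + x (Suc h))"
  proof (cases "x (Suc h) = m")
    case True
    show ?thesis
    proof (rule ccontr)
      assume "\<not> ?thesis"
      with True have "x (Suc h) - x h > n" by simp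
      then show False
        using wide_gap[of h "m - 1"] mono[of "h - 1" h] True h n by fastforce
    qed
  next
    case False
    then have "x i < m" if "i < k" for i
      using mono[of i "Suc h"] range[of "Suc h"] that h by fastforce
    then obtain i j where "i < j" "j < k" "\<bar>x i - m\<bar> + \<bar>x j - m\<bar> \<le> n"
      using cover[of m] m by fastforce
    moreover from this have "x i \<le> x h" "x j \<le> x (Suc h)" using mono h by auto
    ultimately show ?thesis by linarith
  qed
  then show ?thesis using sum_bound[of h] h by (simp add: algebra_simps)
qed

text \<open>The points themselves are sorted, not the set of their abscissae: several of them may
  share a column, and each needs its own index.\<close>

lemma metric_generator_card_bound:
  fixes m n :: nat
  assumes gen: "metric_generator (path_product (Suc m) (Suc n)) S" and fin: "finite S"
    and n: "1 \<le> n" and m: "0 < m"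
  shows "int m \<le> int n * (int (card S) - 1)"
proof -
  obtain l0 where l0: "set l0 = S" "distinct l0" using finite_distinct_list[OF fin] by blast
  define l where "l = sort_key fst l0"
  have l: "set l = S" "distinct l" "length l = card S" "sorted (map fst l)"
    using l0 distinct_card[of l0] by (auto simp: l_def)
  show ?thesis
  proof (rule sorted_cover_bound[where x = "\<lambda>i. int (fst (l ! i))"])
    show "1 \<le> int n" "0 < int m" using n m by auto
    show "int (fst (l ! i)) \<le> int (fst (l ! j))" if "i \<le> j" "j < card S" for i j
      using sorted_nth_mono[OF l(4), of i j] that l(3) by simp
    show "0 \<le> int (fst (l ! i)) \<and> int (fst (l ! i)) \<le> int m" if "i < card S" for i
    proof -
      have "l ! i \<in> S" using that l by (metis nth_mem)
      then show ?thesis using gen by (auto simp: metric_generator_path_product_iff)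
    qed
    fix c :: int assume "0 \<le> c" "c \<le> int m"
    then obtain c' where c': "c = int c'" "c' \<le> m" by (metis nonneg_int_cases of_nat_le_iff)
    have index: "\<exists>i<card S. l ! i = s" if "s \<in> S" for s
      using that l by (metis in_set_conv_nth)
    from column_cover[OF gen fin n c'(2)]
    show "(\<exists>i<card S. int (fst (l ! i)) = c) \<or> (\<exists>i j. i < j \<and> j < card S \<and>
      \<bar>int (fst (l ! i)) - c\<bar> + \<bar>int (fst (l ! j)) - c\<bar> \<le> int n)"
    proof (elim disjE bexE conjE)
      fix s assume "s \<in> S" "fst s = c'"
      then show ?thesis using index c' by blast
    next
      fix s s' assume s: "s \<in> S" "s' \<in> S" "s \<noteq> s'"
        and le: "\<bar>int (fst s) - int c'\<bar> + \<bar>int (fst s') - int c'\<bar> \<le> int n"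
      obtain i j where ij: "i < card S" "j < card S" "l ! i = s" "l ! j = s'"
        using index s by blast
      then have "i < j \<or> j < i" using s by (metis linorder_neqE_nat)
      then show ?thesis using ij le c' by (auto simp: add.commute)
    qed
  qed
qed

section \<open>The minimum and its closed form\<close>

theorem theorem19:
  fixes t t' :: nat
  assumes "2 \<le> t'" and "t' < t"
  shows "int (metric_dim (strong_product (path_graph t) (path_graph t')))
    = \<lceil>(real t + real t' - 2) / (real t' - 1)\<rceil>"
proof -
  define m n where "m = t - 1" and "n = t' - 1"
  have t: "t = Suc m" "t' = Suc n" and mn: "1 \<le> n" "n < m"
    using assms by (auto simp: m_def n_def)
  define K where "K = nat \<lceil>real m / real n\<rceil>"
  have K_int: "int K = \<lceil>real m / real n\<rceil>"
    by (simp add: K_def less_le_trans[of _ 0])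
  then have "real K - 1 < real m / real n" "real m / real n \<le> real K"
    by linarith+
  then have K_real: "(real K - 1) * real n < real m" "real m \<le> real K * real n"
    using mn by (auto simp: field_simps)
  have "K > 0" using K_real(2) mn by (intro gr0I) auto
  then have "real (n * (K - 1)) < real m" "real m \<le> real (n * K)"
    using K_real by (auto simp: mult.commute)
  then have K: "n * (K - 1) < m" "m \<le> n * K"
    by linarith+
  have lower: "Suc K \<le> card S" if "finite S" "metric_generator (path_product t t') S" for S
  proof -
    have "int m \<le> int n * (int (card S) - 1)"
      using that mn unfolding t by (intro metric_generator_card_bound) auto
    moreover have "int n * (int K - 1) < int m"
      using K(1) \<open>K > 0\<close> of_nat_less_iff[of "n * (K - 1)" m, where 'a = int] by simp
    ultimately have "int n * (int K - 1) < int n * (int (card S) - 1)" by linarith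
    then show ?thesis using mn by simp
  qed
  define Z where "Z = (\<lambda>i. (min (i * n) m, if even i then 0 else n)) ` {..K}"
  have Z: "finite Z" "metric_generator (path_product t t') Z"
    unfolding Z_def t by (simp, rule zigzag_metric_generator[OF mn K])
  \<comment> \<open>Injectivity of the zigzag need not be checked: \<open>lower\<close> supplies the
    reverse inequality.\<close>
  have "card Z \<le> Suc K" unfolding Z_def using card_image_le[OF finite_atMost] by (metis card_atMost)
  with lower[OF Z] have "card Z = Suc K" by simp
  have "metric_dim (path_product t t') = Suc K"
    unfolding metric_dim_def
  proof (rule Least_equality)
    show "\<exists>S. finite S \<and> metric_generator (path_product t t') S \<and> card S = Suc K"
      using Z \<open>card Z = Suc K\<close> by (intro exI[of _ Z] conjI)
  next
    fix k
    assume "\<exists>S. finite S \<and> metric_generator (path_product t t') S \<and> card S = k"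
    then show "Suc K \<le> k" using lower by (elim exE conjE) metis
  qed
  moreover have "(real t + real t' - 2) / (real t' - 1) = real m / real n + 1"
    using mn by (simp add: t field_simps)
  ultimately show ?thesis using K_int by simp
qed

end
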